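(* Let $K\in\mathbb{N}$ and $\varepsilon>0$. Any (possibly randomized) streaming algorithm in the element-store model for maximizing a non-negative monotone submodular function $f\colon 2^E\to\mathbb{R}_+$ on an $n$-element ground set $E$ subject to the cardinality constraint $|S|\le K$ that achieves approximation ratio $\frac{2}{2+\sqrt{2}}+\varepsilon$ requires $\Omega\left(\frac{n}{K^2}\right)$ space.
   Context: A set function $f\colon 2^E\to\mathbb{R}$ is submodular if $f(S\cup\{e\})-f(S)\ge f(T\cup\{e\})-f(T)$ for all $S\subseteq T\subsetneq E$ and $e\in E\setminus T$, and monotone if $f(S)\le f(T)$ whenever $S\subseteq T$. Element-store model: the elements of $E=\{e_1,\dots,e_n\}$ arrive one by one in a stream (single pass). The algorithm maintains a set of elements $S$ (initially empty) and an additional memory $M$. At step $t\in\{1,\dots,n\}$ the element $e_t$ is given, and the algorithm updates $S$ and the content of $M$ using only the values $f(S')$ for $S'\subseteq S\cup\{e_t\}$ and the content of $M$. At the end it outputs a subset of $S$. The space complexity is the number of words stored in $M$ plus the maximum size of $S$ over the $n$ steps. An algorithm has approximation ratio $\alpha$ if on every instance it outputs a feasible set whose (expected, over the algorithm's randomness) value is at least $\alpha$ times the optimal feasible value.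
   Formalization: The bound is proved for all K at least some threshold depending only on ε (and for all n, with a constant depending only on ε); for K = 1 the claim fails, since keeping the best single element seen so far is exact with space 1. *)

theory Defs
  imports "HOL-Probability.Probability"
begin

definition submodular_on :: "'a set \<Rightarrow> ('a set \<Rightarrow> real) \<Rightarrow> bool" where
  "submodular_on E f \<longleftrightarrow>
     (\<forall>S T e. S \<subseteq> T \<and> T \<subset> E \<and> e \<in> E - T \<longrightarrow>
        f (S \<union> {e}) - f S \<ge> f (T \<union> {e}) - f T)"

text \<open>An instance consists of an arrival order of the ground set and an objective function.
  Only the values of the objective on subsets of the ground set matter.\<close>

definition is_instance :: "'a set \<Rightarrow> 'a list \<Rightarrow> ('a set \<Rightarrow> real) \<Rightarrow> bool" where
  "is_instance E es f \<longleftrightarrow>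
     distinct es \<and> set es = E \<and>
     (\<forall>S\<subseteq>E. 0 \<le> f S) \<and> mono_on (Pow E) f \<and> submodular_on E f"

definition feasible_sets :: "'a set \<Rightarrow> nat \<Rightarrow> 'a set set" where
  "feasible_sets E K = {S. S \<subseteq> E \<and> card S \<le> K}"

definition opt_value :: "'a set \<Rightarrow> nat \<Rightarrow> ('a set \<Rightarrow> real) \<Rightarrow> real" where
  "opt_value E K f = Max (f ` feasible_sets E K)"

text \<open>A deterministic algorithm in the element-store model. The memory is a list of words over an
  arbitrary word type \<open>'w\<close>. The last argument of \<open>update\<close> and of \<open>final_output\<close> is the value oracle;
  \<open>state\<close> and \<open>result\<close> below restrict it to the sets that may be queried.\<close>

record ('a, 'w) es_algorithm =
  init_memory :: "'w list"
  update :: "'a set \<Rightarrow> 'w list \<Rightarrow> 'a \<Rightarrow> ('a set \<Rightarrow> real) \<Rightarrow> 'a set \<times> 'w list"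
  final_output :: "'a set \<Rightarrow> 'w list \<Rightarrow> ('a set \<Rightarrow> real) \<Rightarrow> 'a set"

definition element_store :: "('a, 'w) es_algorithm \<Rightarrow> bool" where
  "element_store A \<longleftrightarrow>
     (\<forall>S M e q. fst (update A S M e q) \<subseteq> insert e S) \<and>
     (\<forall>S M q. final_output A S M q \<subseteq> S)"

primrec state ::
  "('a, 'w) es_algorithm \<Rightarrow> 'a list \<Rightarrow> ('a set \<Rightarrow> real) \<Rightarrow> nat \<Rightarrow> 'a set \<times> 'w list" where
  "state A es f 0 = ({}, init_memory A)"
| "state A es f (Suc t) =
     (let (S, M) = state A es f t; e = es ! t
      in update A S M e (restrict f (Pow (insert e S))))"

definition result :: "('a, 'w) es_algorithm \<Rightarrow> 'a list \<Rightarrow> ('a set \<Rightarrow> real) \<Rightarrow> 'a set" where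
  "result A es f =
     (let (S, M) = state A es f (length es) in final_output A S M (restrict f (Pow S)))"

definition run_space :: "('a, 'w) es_algorithm \<Rightarrow> 'a list \<Rightarrow> ('a set \<Rightarrow> real) \<Rightarrow> nat" where
  "run_space A es f =
     (MAX t\<in>{..length es}. length (snd (state A es f t))) +
     (MAX t\<in>{..length es}. card (fst (state A es f t)))"

text \<open>A randomized algorithm is a family of deterministic algorithms indexed by a random seed
  drawn from an arbitrary probability space \<open>R\<close>. The seed is not charged to the memory, so this
  also covers algorithms that toss fresh coins at every step. Deterministic algorithms are the
  case of a constant family.\<close>

definition randomized_algorithm ::
  "'a set \<Rightarrow> 'r measure \<Rightarrow> ('r \<Rightarrow> ('a, 'w) es_algorithm) \<Rightarrow> bool" where
  "randomized_algorithm E R A \<longleftrightarrow>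
     prob_space R \<and>
     (\<forall>\<omega>\<in>space R. element_store (A \<omega>)) \<and>
     (\<forall>es f. is_instance E es f \<longrightarrow>
        (\<lambda>\<omega>. result (A \<omega>) es f) \<in> measurable R (count_space (Pow E)))"

definition achieves_ratio ::
  "'a set \<Rightarrow> nat \<Rightarrow> 'r measure \<Rightarrow> ('r \<Rightarrow> ('a, 'w) es_algorithm) \<Rightarrow> real \<Rightarrow> bool" where
  "achieves_ratio E K R A \<alpha> \<longleftrightarrow>
     (\<forall>es f. is_instance E es f \<longrightarrow>
        (\<forall>\<omega>\<in>space R. result (A \<omega>) es f \<in> feasible_sets E K) \<and>
        prob_space.expectation R (\<lambda>\<omega>. f (result (A \<omega>) es f)) \<ge> \<alpha> * opt_value E K f)"

text \<open>Worst case over all instances and all random seeds.\<close>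

definition space_complexity ::
  "'a set \<Rightarrow> 'r measure \<Rightarrow> ('r \<Rightarrow> ('a, 'w) es_algorithm) \<Rightarrow> enat" where
  "space_complexity E R A =
     Sup {enat (run_space (A \<omega>) es f) | \<omega> es f. \<omega> \<in> space R \<and> is_instance E es f}"

end

theory Submission
  imports Defs
begin

text \<open>
  Hide a uniformly random set \<open>H\<close> of \<open>m = K - 1\<close> elements among the first \<open>n - 1\<close> arrivals; the last
  arrival is a special element \<open>\<tau>\<close>. The objective depends only on the number \<open>a\<close> of plain elements,
  the number \<open>b\<close> of hidden elements and on whether \<open>\<tau>\<close> is chosen. A hidden element always has
  marginal \<open>w(a)\<close>, and a plain element has marginal \<open>w(a)\<close> as long as \<open>b = 0\<close> and \<open>\<tau>\<close> is absent, so
  hidden and plain elements cannot be told apart before two hidden elements are held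
  simultaneously. That happens only if \<open>e_t \<in> H\<close> while the store meets \<open>H\<close>, which has probability
  at most about \<open>s m\<^sup>2 / n\<close> for a store of size \<open>s\<close>. Otherwise the output contains at most one hidden
  element, and its value is at most \<open>2 / (2 + \<surd>2) + o(1)\<close> times the value of \<open>H \<union> {\<tau>}\<close>.
\<close>

text \<open>The weight \<open>w\<close> decreases linearly up to \<open>p\<close> and geometrically afterwards (both subtractions are
  truncated). Submodularity forces \<open>w\<close> to be convex and to lose at most the fraction \<open>1 / m\<close> of its
  value per step; within these limits the optimal breakpoint is \<open>p \<approx> \<surd>2 m\<close>.\<close>

definition hidden_weight :: "nat \<Rightarrow> nat \<Rightarrow> nat \<Rightarrow> real" where
  "hidden_weight m p a = real (p - a) + real m * (1 - 1 / real m) ^ (a - p)"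

definition plain_value :: "nat \<Rightarrow> nat \<Rightarrow> nat \<Rightarrow> real" where
  "plain_value m p a = (\<Sum>i<a. hidden_weight m p i)"

text \<open>For \<open>m \<ge> 1\<close> this is the sum of \<open>hidden_weight m p i\<close> over
  all \<open>i\<close>: the indices below \<open>p\<close> contribute
  \<open>p * (p + 1) / 2 + m * p\<close>, the geometric tail \<open>m * m\<close>. It is the value
  of \<open>insert \<tau> H\<close> when \<open>card H = m\<close>.\<close>

definition hard_opt :: "nat \<Rightarrow> nat \<Rightarrow> real" where
  "hard_opt m p = real m * (real p + real m) + real p * (real p + 1) / 2"

text \<open>With \<open>\<tau>\<close> the value falls short of \<open>hard_opt\<close> by one
  weight per missing hidden element, which gives hidden elements the same marginal in both
  branches.\<close>

definition hard_profile :: "nat \<Rightarrow> nat \<Rightarrow> nat \<Rightarrow> nat \<Rightarrow> bool \<Rightarrow> real" where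
  "hard_profile m p a b c =
     (if c then hard_opt m p - (real m - real b) * hidden_weight m p a
      else plain_value m p a + real b * hidden_weight m p a)"

text \<open>The empty \<open>H\<close> is a legitimate argument: it gives the reference objective,
  whose run cannot depend on the hidden set.\<close>

definition hard_fun :: "nat \<Rightarrow> nat \<Rightarrow> 'a \<Rightarrow> 'a set \<Rightarrow> 'a set \<Rightarrow> real" where
  "hard_fun m p \<tau> H S = hard_profile m p (card (S - insert \<tau> H)) (card (S \<inter> H)) (\<tau> \<in> S)"

section \<open>The weight function\<close>

text \<open>Below \<open>p\<close> only the linear part drops, by 1; from \<open>p\<close> on the
  weight is geometric and loses the fraction \<open>1 / m\<close>. The truncated exponent merges
  both cases.\<close>

lemma hidden_weight_diff:
  assumes "m \<ge> 1"
  shows "hidden_weight m p a - hidden_weight m p (Suc a) = (1 - 1 / real m) ^ (a - p)"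
proof (cases "a < p")
  case True
  then show ?thesis by (simp add: hidden_weight_def of_nat_diff)
next
  case False
  then have "Suc a - p = Suc (a - p)" by simp
  with False assms show ?thesis by (simp add: hidden_weight_def field_simps)
qed

lemma decay_nonneg: "m \<ge> 1 \<Longrightarrow> 0 \<le> (1 - 1 / real m) ^ k"
  by simp

lemma decay_antimono: "m \<ge> 1 \<Longrightarrow> k \<le> l \<Longrightarrow> (1 - 1 / real m) ^ l \<le> (1 - 1 / real m) ^ k"
  by (intro power_decreasing) auto

lemma hidden_weight_nonneg: "m \<ge> 1 \<Longrightarrow> 0 \<le> hidden_weight m p a"
  by (simp add: hidden_weight_def)

lemma hidden_weight_antimono:
  assumes "m \<ge> 1" "a \<le> a'"
  shows "hidden_weight m p a' \<le> hidden_weight m p a"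
proof (rule lift_Suc_antimono_le[of "hidden_weight m p", OF _ assms(2)])
  show "hidden_weight m p (Suc k) \<le> hidden_weight m p k" for k
    using hidden_weight_diff[OF assms(1), of p k] decay_nonneg[OF assms(1), of "k - p"] by linarith
qed

text \<open>The two subtracted terms are the tail of the weight sum from index \<open>a\<close>
  on.\<close>

lemma plain_value_eq:
  assumes "m \<ge> 1"
  shows "plain_value m p a
    = hard_opt m p - real m * hidden_weight m p a - real (p - a) * (real (p - a) + 1) / 2"
proof (induction a)
  case 0
  then show ?case by (simp add: plain_value_def hard_opt_def hidden_weight_def algebra_simps)
next
  case (Suc a)
  have *: "hidden_weight m p (Suc a) = hidden_weight m p a - (1 - 1 / real m) ^ (a - p)"
    using hidden_weight_diff[OF assms, of p a] by simp
  have "plain_value m p (Suc a) = plain_value m p a + hidden_weight m p a"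
    by (simp add: plain_value_def)
  also have "\<dots> = hard_opt m p - real m * hidden_weight m p (Suc a)
      - real (p - Suc a) * (real (p - Suc a) + 1) / 2"
    unfolding Suc.IH *
    by (cases "a < p") (simp_all add: hidden_weight_def of_nat_diff field_simps)
  finally show ?case .
qed

text \<open>These differences are the plain marginals without \<open>\<tau>\<close>. Below
  \<open>p\<close> the subtracted term is constant in \<open>a\<close>; from \<open>p\<close> on it
  shrinks by \<open>b' / m\<close> times the drop of the weight, and
  \<open>b' \<le> m\<close>.\<close>

lemma hidden_weight_step_antimono:
  assumes "m \<ge> 1" "a \<le> a'" "b \<le> b'" "b' \<le> m"
  shows "hidden_weight m p a' - real b' * (1 - 1 / real m) ^ (a' - p)
       \<le> hidden_weight m p a - real b * (1 - 1 / real m) ^ (a - p)"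
proof -
  let ?g = "\<lambda>a. hidden_weight m p a - real b' * (1 - 1 / real m) ^ (a - p)"
  have "?g (Suc a) \<le> ?g a" for a
  proof (cases "a < p")
    case True
    then show ?thesis using hidden_weight_diff[OF assms(1), of p a] by simp
  next
    case False
    then have s: "Suc a - p = Suc (a - p)" by simp
    have d: "real b' / real m * (1 - 1 / real m) ^ (a - p) \<le> 1 * (1 - 1 / real m) ^ (a - p)"
      using assms by (intro mult_right_mono decay_nonneg) auto
    show ?thesis unfolding s using hidden_weight_diff[OF assms(1), of p a] d
      by (simp add: algebra_simps)
  qed
  then have "?g a' \<le> ?g a"
    using assms(2) by (rule lift_Suc_antimono_le[of ?g])
  moreover have "real b * (1 - 1 / real m) ^ (a - p) \<le> real b' * (1 - 1 / real m) ^ (a - p)"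
    using assms by (intro mult_right_mono decay_nonneg) auto
  ultimately show ?thesis by linarith
qed

section \<open>Marginals of the profile\<close>

lemma profile_plain_step:
  assumes "m \<ge> 1"
  shows "hard_profile m p (Suc a) b c - hard_profile m p a b c =
    (if c then (real m - real b) * (1 - 1 / real m) ^ (a - p)
     else hidden_weight m p a - real b * (1 - 1 / real m) ^ (a - p))"
proof -
  have *: "hidden_weight m p (Suc a) = hidden_weight m p a - (1 - 1 / real m) ^ (a - p)"
    using hidden_weight_diff[OF assms, of p a] by simp
  show ?thesis
    unfolding hard_profile_def * plain_value_def by (simp add: algebra_simps)
qed

lemma profile_hidden_step:
  "hard_profile m p a (Suc b) c - hard_profile m p a b c = hidden_weight m p a"
  by (simp add: hard_profile_def algebra_simps)

text \<open>The term \<open>m * hidden_weight m p a\<close> of the closed form cancels, so the gain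
  from \<open>\<tau>\<close> depends on \<open>a\<close> alone and vanishes from \<open>p\<close>
  on.\<close>

lemma profile_last_step:
  assumes "m \<ge> 1"
  shows "hard_profile m p a b True - hard_profile m p a b False
    = real (p - a) * (real (p - a) + 1) / 2"
  by (simp add: hard_profile_def plain_value_eq[OF assms] algebra_simps)

text \<open>Besides the comparison inside each branch, \<open>\<tau>\<close> must not raise a plain
  marginal: its presence lowers that marginal by exactly \<open>p - a\<close>.\<close>

lemma profile_plain_step_antimono:
  assumes "m \<ge> 1" "a \<le> a'" "b \<le> b'" "b' \<le> m" "c \<longrightarrow> c'"
  shows "hard_profile m p (Suc a') b' c' - hard_profile m p a' b' c'
    \<le> hard_profile m p (Suc a) b c - hard_profile m p a b c"
proof -
  have 1: "(real m - real b') * (1 - 1 / real m) ^ (a' - p)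
      \<le> (real m - real b) * (1 - 1 / real m) ^ (a - p)"
    using assms by (intro mult_mono decay_antimono decay_nonneg) auto
  have 2: "(real m - real b) * (1 - 1 / real m) ^ (a - p)
      \<le> hidden_weight m p a - real b * (1 - 1 / real m) ^ (a - p)"
    by (simp add: hidden_weight_def algebra_simps)
  show ?thesis
    using 1 2 hidden_weight_step_antimono[OF assms(1-4), of p] assms(5)
    unfolding profile_plain_step[OF assms(1)] by auto
qed

text \<open>The arguments are raised one at a time; \<open>b \<le> m\<close> keeps the plain
  marginals nonnegative.\<close>

lemma profile_mono:
  assumes "m \<ge> 1" "a \<le> a'" "b \<le> b'" "b' \<le> m" "c \<longrightarrow> c'"
  shows "hard_profile m p a b c \<le> hard_profile m p a' b' c'"
proof -
  have "hard_profile m p a b c \<le> hard_profile m p a' b c"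
  proof (rule lift_Suc_mono_le[of "\<lambda>a. hard_profile m p a b c", OF _ assms(2)])
    fix k
    have "0 \<le> (real m - real b) * (1 - 1 / real m) ^ (k - p)"
      using assms by (intro mult_nonneg_nonneg decay_nonneg) auto
    moreover have "0 \<le> hidden_weight m p k - real b * (1 - 1 / real m) ^ (k - p)"
      using calculation by (simp add: hidden_weight_def algebra_simps)
    ultimately show "hard_profile m p k b c \<le> hard_profile m p (Suc k) b c"
      using profile_plain_step[OF assms(1), of p k b c] by (auto split: if_splits)
  qed
  also have "\<dots> \<le> hard_profile m p a' b' c"
  proof (rule lift_Suc_mono_le[of "\<lambda>b. hard_profile m p a' b c", OF _ assms(3)])
    show "hard_profile m p a' k c \<le> hard_profile m p a' (Suc k) c" for k
      using profile_hidden_step[of m p a' k c] hidden_weight_nonneg[OF assms(1), of p a'] by linarith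
  qed
  also have "\<dots> \<le> hard_profile m p a' b' c'"
  proof (cases "c = c'")
    case False
    then have "\<not> c" "c'" using assms(5) by auto
    moreover have "0 \<le> real (p - a') * (real (p - a') + 1) / 2" by simp
    ultimately show ?thesis
      unfolding profile_last_step[OF assms(1), of p a' b', symmetric] by simp
  qed simp
  finally show ?thesis .
qed

section \<open>From the profile to monotone submodular instances\<close>

lemma hard_fun_mono:
  assumes "m \<ge> 1" "finite T" "finite H" "card H \<le> m" "S \<subseteq> T"
  shows "hard_fun m p \<tau> H S \<le> hard_fun m p \<tau> H T"
  unfolding hard_fun_def
proof (rule profile_mono[OF assms(1)])
  show "card (S - insert \<tau> H) \<le> card (T - insert \<tau> H)"
    using assms by (intro card_mono) auto
  show "card (S \<inter> H) \<le> card (T \<inter> H)"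
    using assms by (intro card_mono) auto
  show "card (T \<inter> H) \<le> m"
    using assms card_mono[of H "T \<inter> H"] by auto
qed (use assms in auto)

lemma hard_fun_empty: "hard_fun m p \<tau> H {} = 0"
  by (simp add: hard_fun_def hard_profile_def plain_value_def)

lemma hard_fun_insert:
  assumes "finite S" "e \<notin> S" "\<tau> \<notin> H"
  shows "hard_fun m p \<tau> H (insert e S) =
    (let a = card (S - insert \<tau> H); b = card (S \<inter> H); c = (\<tau> \<in> S) in
      if e = \<tau> then hard_profile m p a b True
      else if e \<in> H then hard_profile m p a (Suc b) c
      else hard_profile m p (Suc a) b c)"
  using assms
  by (auto simp: hard_fun_def Let_def insert_Diff_if Int_insert_left)

text \<open>An insertion raises exactly one argument of the profile, and each of the three kinds of
  marginal shrinks as the other set grows.\<close>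

lemma hard_fun_submodular:
  assumes "m \<ge> 1" "finite T" "finite H" "card H \<le> m" "\<tau> \<notin> H" "S \<subseteq> T" "e \<notin> T"
  shows "hard_fun m p \<tau> H (insert e T) - hard_fun m p \<tau> H T
       \<le> hard_fun m p \<tau> H (insert e S) - hard_fun m p \<tau> H S"
proof -
  have fS: "finite S" "e \<notin> S" using assms finite_subset by auto
  define a b a' b' where ab: "a = card (S - insert \<tau> H)" "b = card (S \<inter> H)"
    "a' = card (T - insert \<tau> H)" "b' = card (T \<inter> H)"
  have le: "a \<le> a'" "b \<le> b'" "b' \<le> m"
    using assms card_mono[of H "T \<inter> H"] unfolding ab by (auto intro!: card_mono)
  have st: "\<tau> \<in> S \<longrightarrow> \<tau> \<in> T" using assms by auto
  note ins = hard_fun_insert[OF fS assms(5), of m p] hard_fun_insert[OF assms(2,7,5), of m p]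
  note eqs = hard_fun_def[of m p \<tau> H S] hard_fun_def[of m p \<tau> H T]
  consider "e = \<tau>" | "e \<noteq> \<tau>" "e \<in> H" | "e \<noteq> \<tau>" "e \<notin> H" by blast
  then show ?thesis
  proof cases
    case 1
    then have "\<tau> \<notin> S" "\<tau> \<notin> T" using fS assms by auto
    moreover have "real (p - a') * (real (p - a') + 1) / 2 \<le> real (p - a) * (real (p - a) + 1) / 2"
      using le by (intro divide_right_mono mult_mono) auto
    ultimately show ?thesis
      using 1 profile_last_step[OF assms(1), of p a b] profile_last_step[OF assms(1), of p a' b']
      unfolding ins eqs ab[symmetric] Let_def by simp
  next
    case 2
    then show ?thesis
      using hidden_weight_antimono[OF assms(1) le(1), of p]
      unfolding ins eqs ab[symmetric] Let_def by (simp add: profile_hidden_step)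
  next
    case 3
    then show ?thesis
      using profile_plain_step_antimono[OF assms(1) le st, of p]
      unfolding ins eqs ab[symmetric] Let_def by simp
  qed
qed

lemma hard_fun_instance:
  assumes "m \<ge> 1" "distinct es" "set es = E" "H \<subseteq> E" "card H \<le> m" "\<tau> \<notin> H"
  shows "is_instance E es (hard_fun m p \<tau> H)"
proof -
  have fin: "finite E" "finite H" using assms finite_subset by auto
  have mono: "hard_fun m p \<tau> H S \<le> hard_fun m p \<tau> H T" if "S \<subseteq> T" "T \<subseteq> E" for S T
    using that fin assms finite_subset[of T E] by (intro hard_fun_mono) auto
  have "submodular_on E (hard_fun m p \<tau> H)"
    unfolding submodular_on_def
  proof (intro allI impI, elim conjE)
    fix S T e assume "S \<subseteq> T" "T \<subset> E" "e \<in> E - T"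
    then show "hard_fun m p \<tau> H (T \<union> {e}) - hard_fun m p \<tau> H T
        \<le> hard_fun m p \<tau> H (S \<union> {e}) - hard_fun m p \<tau> H S"
      using hard_fun_submodular[of m T H \<tau> S e p] assms fin finite_subset[of T E] by auto
  qed
  moreover have "\<forall>S\<subseteq>E. 0 \<le> hard_fun m p \<tau> H S"
    using mono[of "{}"] by (simp add: hard_fun_empty)
  moreover have "mono_on (Pow E) (hard_fun m p \<tau> H)"
    using mono by (auto intro!: mono_onI)
  ultimately show ?thesis using assms by (simp add: is_instance_def)
qed

section \<open>Output values against the optimum\<close>

text \<open>One hidden element on top of \<open>a\<close> plain ones adds
  \<open>hidden_weight m p a\<close>, exactly the next summand of \<open>plain_value\<close>. Such
  sets reveal nothing about \<open>H\<close>.\<close>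

lemma hard_fun_few_hidden:
  assumes "finite S" "\<tau> \<notin> S" "card (S \<inter> H) \<le> 1"
  shows "hard_fun m p \<tau> H S = plain_value m p (card S)"
proof -
  have "S - insert \<tau> H = S - H" using assms by auto
  moreover have "card S = card (S - H) + card (S \<inter> H)"
    using assms by (metis card_Int_Diff add.commute)
  moreover have "card (S \<inter> H) = 0 \<or> card (S \<inter> H) = 1" using assms by linarith
  ultimately show ?thesis
    using assms by (auto simp: hard_fun_def hard_profile_def plain_value_def)
qed

text \<open>Raising \<open>b\<close> to \<open>m\<close> and adding \<open>\<tau>\<close> gives
  \<open>hard_opt\<close>, whatever the number of plain elements.\<close>

lemma hard_fun_le_opt:
  assumes "m \<ge> 1" "finite S" "finite H" "card H \<le> m"
  shows "hard_fun m p \<tau> H S \<le> hard_opt m p"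
proof -
  have "hard_fun m p \<tau> H S \<le> hard_profile m p (card (S - insert \<tau> H)) m True"
    unfolding hard_fun_def
    using assms card_mono[of H "S \<inter> H"] by (intro profile_mono) auto
  then show ?thesis by (simp add: hard_profile_def)
qed

lemma opt_value_hard_fun:
  assumes "m \<ge> 1" "finite E" "H \<subseteq> E" "card H = m" "\<tau> \<in> E" "\<tau> \<notin> H"
  shows "hard_opt m p \<le> opt_value E (Suc m) (hard_fun m p \<tau> H)"
proof -
  have fin: "finite H" using assms finite_subset by auto
  have "finite (feasible_sets E (Suc m))"
    using assms by (auto simp: feasible_sets_def)
  moreover have "insert \<tau> H \<in> feasible_sets E (Suc m)"
    using assms fin by (auto simp: feasible_sets_def)
  moreover have "hard_fun m p \<tau> H (insert \<tau> H) = hard_opt m p"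
    using assms by (simp add: hard_fun_def hard_profile_def Int_absorb1 Int_insert_left)
  ultimately show ?thesis unfolding opt_value_def
    by (metis Max_ge finite_imageI imageI)
qed

text \<open>The first argument of \<open>max\<close> bounds outputs without \<open>\<tau>\<close>,
  the second those with it.\<close>

lemma hard_fun_output_bound:
  assumes m: "m \<ge> 1" and p: "m \<le> p" and S: "finite S" "card S \<le> Suc m" "card (S \<inter> H) \<le> 1"
    and H: "finite H" "card H \<le> m" "\<tau> \<notin> H"
  shows "hard_fun m p \<tau> H S \<le>
    max ((real m + 1) * (real m / 2 + real p)) (hard_opt m p - (real m - 1) * real p)"
proof (cases "\<tau> \<in> S")
  case True
  \<comment> \<open>\<open>\<tau>\<close> takes one of the \<open>m + 1\<close> places. Rounding up
    to \<open>m\<close> plain elements and one hidden one is harmless by monotonicity, and the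
    weight at \<open>m\<close> is \<open>p\<close>.\<close>
  have "card (S - insert \<tau> H) \<le> card (S - {\<tau>})" using S by (intro card_mono) auto
  also have "\<dots> \<le> m" using S True by simp
  finally have a: "card (S - insert \<tau> H) \<le> m" .
  have "hard_fun m p \<tau> H S \<le> hard_profile m p m 1 True"
    unfolding hard_fun_def using a S m by (intro profile_mono) auto
  also have "\<dots> = hard_opt m p - (real m - 1) * real p"
    using p by (simp add: hard_profile_def hidden_weight_def of_nat_diff)
  finally show ?thesis by simp
next
  case False
  \<comment> \<open>Up to index \<open>m \<le> p\<close> the weights are on the linear piece, so
    their sum is arithmetic.\<close>
  have w: "hidden_weight m p i = real p + real m - real i" if "i \<le> m" for i
    using that p by (simp add: hidden_weight_def of_nat_diff)
  have "plain_value m p k = real k * (real p + real m) - real k * (real k - 1) / 2"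
    if "k \<le> Suc m" for k
    using that
  proof (induction k)
    case (Suc k)
    then show ?case by (simp add: plain_value_def w field_simps)
  qed (simp add: plain_value_def)
  from this[of "Suc m"]
  have "plain_value m p (Suc m) = (real m + 1) * (real m / 2 + real p)"
    by (simp add: field_simps)
  moreover have "plain_value m p (card S) \<le> plain_value m p (Suc m)"
    unfolding plain_value_def using S hidden_weight_nonneg[OF m]
    by (intro sum_mono2) auto
  ultimately show ?thesis
    using hard_fun_few_hidden[OF S(1) False S(3), of m p] by simp
qed

text \<open>To leading order the second bound divided by \<open>hard_opt\<close> is
  \<open>1 - 1 / (1 + m / p + p / (2 * m))\<close>. It is least at \<open>p = sqrt 2 * m\<close>,
  with value \<open>2 - sqrt 2\<close>; the first bound is smaller there, and
  \<open>\<epsilon> / 2\<close> absorbs the lower-order terms.\<close>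

lemma hard_ratio:
  fixes \<epsilon> :: real
  assumes \<epsilon>: "\<epsilon> > 0" and m: "m \<ge> 1" "8 / \<epsilon> \<le> real m"
  obtains p where "m \<le> p"
    "max ((real m + 1) * (real m / 2 + real p)) (hard_opt m p - (real m - 1) * real p)
       \<le> (2 / (2 + sqrt 2) + \<epsilon> / 2) * hard_opt m p"
proof
  define r where "r = sqrt (2::real)"
  define x where "x = real m"
  have r2: "r * r = 2" by (simp add: r_def)
  have rz: "r * (r * z) = 2 * z" for z using r2 by (metis mult.assoc)
  have rl: "1.4 \<le> r" unfolding r_def by (rule real_le_rsqrt) (simp add: power2_eq_square)
  have ru: "r \<le> 1.5" unfolding r_def by (rule real_le_lsqrt) (auto simp: power2_eq_square)
  define p where "p = nat \<lceil>r * x\<rceil>"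
  define y where "y = real p"
  have x1: "1 \<le> x" using m by (simp add: x_def)
  have rx: "0 \<le> r * x" "x \<le> r * x" using rl x1 by auto
  have y: "r * x \<le> y" "y \<le> r * x + 1"
    unfolding y_def p_def using rx by linarith+
  have "x \<le> y" using y rx by linarith
  then show "m \<le> p" by (simp add: x_def y_def)
  define D where "D = hard_opt m p"
  have D: "D = x * (y + x) + y * (y + 1) / 2"
    by (simp add: D_def hard_opt_def x_def y_def)
  have al: "2 / (2 + sqrt 2) = 2 - r"
    using r2 rl by (simp add: r_def[symmetric] field_simps)
  have x0: "0 \<le> x" and y0: "0 \<le> y" using x1 \<open>x \<le> y\<close> by auto
  \<comment> \<open>A linear error of \<open>4 * x\<close> is affordable because
    \<open>8 / \<epsilon> \<le> m\<close>.\<close>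
  have "x * x \<le> D" unfolding D using x0 y0 by (simp add: algebra_simps)
  moreover have "4 * x \<le> \<epsilon> / 2 * (x * x)"
    using m \<epsilon> x1 by (simp add: x_def field_simps)
  ultimately have eps: "4 * x \<le> \<epsilon> / 2 * D"
    using mult_left_mono[of "x * x" D "\<epsilon> / 2"] \<epsilon> by linarith
  have yy: "(r * x) * (r * x) \<le> y * y" "y * y \<le> (r * x + 1) * (r * x + 1)"
    using y rx y0 by (auto intro!: mult_mono)
  have xy: "x * (r * x) \<le> x * y" "x * y \<le> x * (r * x + 1)"
    using y x0 by (auto intro!: mult_left_mono)
  have rr: "(r * x) * (r * x) = 2 * (x * x)" using r2 by (simp add: algebra_simps)
  have D': "D = x * y + x * x + y * y / 2 + y / 2" unfolding D by (simp add: field_simps)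
  \<comment> \<open>\<open>(2 + r) * (x * x)\<close> is the leading term of \<open>D\<close>. The
    lower bound \<open>Dl\<close> serves the first argument of \<open>max\<close>, the upper bound
    \<open>Du\<close> the second.\<close>
  have "(2 + r) * (x * x) = 2 * (x * x) + x * (r * x)" by (simp add: algebra_simps)
  then have Dl: "(2 + r) * (x * x) \<le> D"
    unfolding D' using yy xy rr y0 by linarith
  have "(r * x + 1) * (r * x + 1) = (r * x) * (r * x) + 2 * (r * x) + 1"
    by (simp add: algebra_simps)
  then have "y * y \<le> 2 * (x * x) + 2 * (r * x) + 1"
    using yy(2) rr by linarith
  then have "D \<le> x * (r * x + 1) + x * x + (2 * (x * x) + 2 * (r * x) + 1) / 2 + (r * x + 1) / 2"
    unfolding D' using xy y by (intro add_mono divide_right_mono) auto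
  also have "\<dots> = (2 + r) * (x * x) + (1 + 3 * r / 2) * x + 1"
    by (simp add: field_simps)
  finally have Du: "D \<le> (2 + r) * (x * x) + (1 + 3 * r / 2) * x + 1" .
  have rx': "r * x \<le> 1.5 * x" using mult_right_mono[OF ru x0] .
  then have "x / 2 + y \<le> 2 * x + 1" using y by linarith
  then have "(x + 1) * (x / 2 + y) \<le> (x + 1) * (2 * x + 1)"
    using x0 by (intro mult_left_mono) auto
  also have "\<dots> \<le> 2 * (x * x) + 4 * x" using x1 by (simp add: algebra_simps)
  \<comment> \<open>The identity \<open>(2 - r) * (2 + r) = 2\<close> brings in the target
    ratio.\<close>
  also have "2 * (x * x) = (2 - r) * ((2 + r) * (x * x))"
    by (simp add: algebra_simps rz)
  also have "(2 - r) * ((2 + r) * (x * x)) + 4 * x \<le> (2 - r) * D + \<epsilon> / 2 * D"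
    using Dl ru eps by (intro add_mono mult_left_mono) auto
  finally have A: "(x + 1) * (x / 2 + y) \<le> (2 - r + \<epsilon> / 2) * D" by (simp add: algebra_simps)
  \<comment> \<open>For the second argument, \<open>(r - 1) * D - (x - 1) * y\<close> must stay
    within the error. Since \<open>(r - 1) * (2 + r) = r\<close>, the quadratic terms
    cancel.\<close>
  have "(r - 1) * D \<le> (r - 1) * ((2 + r) * (x * x) + (1 + 3 * r / 2) * x + 1)"
    using Du rl by (intro mult_left_mono) auto
  also have "\<dots> = r * (x * x) + (2 - r / 2) * x + (r - 1)"
    by (simp add: field_simps rz)
  finally have "(r - 1) * D \<le> r * (x * x) + (2 - r / 2) * x + (r - 1)" .
  moreover have "r * (x * x) - r * x \<le> (x - 1) * y"
    using mult_left_mono[OF y(1), of "x - 1"] x1 by (simp add: algebra_simps)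
  moreover have "(2 - r / 2) * x = 2 * x - r * x / 2" by (simp add: algebra_simps)
  ultimately have "(r - 1) * D - (x - 1) * y \<le> 4 * x"
    using rx rx' ru x1 by linarith
  with eps have B: "D - (x - 1) * y \<le> (2 - r + \<epsilon> / 2) * D" by (simp add: algebra_simps)
  show "max ((real m + 1) * (real m / 2 + real p)) (hard_opt m p - (real m - 1) * real p)
       \<le> (2 / (2 + sqrt 2) + \<epsilon> / 2) * hard_opt m p"
    using A B unfolding al D_def x_def y_def by simp
qed

section \<open>Counting hidden sets through a pair\<close>

text \<open>Deleting \<open>x\<close> and \<open>y\<close> leaves an arbitrary subset of size
  \<open>m - 2\<close> of the rest; the absorption identity for binomials, applied twice, gives the
  product form.\<close>

lemma card_subsets_containing_pair:
  assumes "finite E" "x \<in> E" "y \<in> E" "x \<noteq> y" "2 \<le> m"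
  shows "real (card {H. H \<subseteq> E \<and> card H = m \<and> x \<in> H \<and> y \<in> H}) * (real (card E) * (real (card E) - 1))
    = real m * (real m - 1) * real (card E choose m)"
proof -
  obtain k where k: "m = Suc (Suc k)" using assms(5) by (metis add_2_eq_Suc le_Suc_ex)
  have c2: "card (E - {x, y}) = card E - 2" using assms by (simp add: card_Diff_subset)
  have "2 \<le> card E" using card_mono[OF assms(1), of "{x, y}"] assms by simp
  then obtain j where j: "card E = Suc (Suc j)" by (metis add_2_eq_Suc le_Suc_ex)
  let ?B = "{X. X \<subseteq> E - {x, y} \<and> card X = k}"
  have fin: "finite X" if "X \<in> ?B" for X using that assms(1) finite_subset[of X E] by auto
  have "{H. H \<subseteq> E \<and> card H = m \<and> x \<in> H \<and> y \<in> H} = (\<lambda>X. insert x (insert y X)) ` ?B"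
  proof (intro equalityI subsetI)
    fix H assume H: "H \<in> {H. H \<subseteq> E \<and> card H = m \<and> x \<in> H \<and> y \<in> H}"
    then have "card (H - {x, y}) = k"
      using assms k by (subst card_Diff_subset) auto
    with H show "H \<in> (\<lambda>X. insert x (insert y X)) ` ?B"
      by (intro image_eqI[of _ _ "H - {x, y}"]) auto
  next
    fix H assume "H \<in> (\<lambda>X. insert x (insert y X)) ` ?B"
    then obtain X where X: "X \<in> ?B" "H = insert x (insert y X)" by auto
    then have "x \<notin> X" "y \<notin> X" by auto
    then show "H \<in> {H. H \<subseteq> E \<and> card H = m \<and> x \<in> H \<and> y \<in> H}"
      using X fin[OF X(1)] assms k by auto
  qed
  moreover have "inj_on (\<lambda>X. insert x (insert y X)) ?B"
    by (rule inj_onI) blast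
  ultimately have "card {H. H \<subseteq> E \<and> card H = m \<and> x \<in> H \<and> y \<in> H} = j choose k"
    using c2 j n_subsets[of "E - {x, y}" k] assms(1) by (simp add: card_image)
  moreover have "Suc (Suc k) * (Suc k * (Suc (Suc j) choose Suc (Suc k)))
      = Suc (Suc j) * (Suc j * (j choose k))"
    by (metis Suc_times_binomial mult.left_commute)
  then have "real (Suc (Suc k)) * (real (Suc k) * real (Suc (Suc j) choose Suc (Suc k)))
      = real (Suc (Suc j)) * (real (Suc j) * real (j choose k))"
    by (metis of_nat_mult)
  ultimately show ?thesis unfolding k j by (simp add: mult_ac)
qed

section \<open>Locality of element-store runs\<close>

lemma state_Suc_subset:
  assumes "element_store A"
  shows "fst (state A es f (Suc t)) \<subseteq> insert (es ! t) (fst (state A es f t))"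
  using assms by (simp add: element_store_def split_beta Let_def)

lemma state_subset:
  assumes "element_store A" "t \<le> length es"
  shows "fst (state A es f t) \<subseteq> set (take t es)"
  using assms(2)
proof (induction t)
  case (Suc t)
  then show ?case
    using state_Suc_subset[OF assms(1), of es f t] by (auto simp: take_Suc_conv_app_nth)
qed simp

text \<open>Agreement is demanded only on sets that may be queried in the run on \<open>g\<close>:
  by induction the run on \<open>f\<close> has the same store and memory, hence the same
  queries.\<close>

lemma state_cong:
  assumes "\<And>u X. u < t \<Longrightarrow> X \<subseteq> insert (es ! u) (fst (state A es g u)) \<Longrightarrow> f X = g X"
  shows "state A es f t = state A es g t"
  using assms
proof (induction t)
  case (Suc t)
  have IH: "state A es f t = state A es g t"
    using Suc.prems less_SucI by (intro Suc.IH) blast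
  have "restrict f (Pow (insert (es ! t) (fst (state A es g t))))
      = restrict g (Pow (insert (es ! t) (fst (state A es g t))))"
    using Suc.prems[of t] by (intro restrict_ext) auto
  then show ?case by (simp add: IH split_beta Let_def)
qed simp

lemma result_subset:
  assumes "element_store A"
  shows "result A es f \<subseteq> fst (state A es f (length es))"
  using assms by (auto simp: result_def element_store_def split_beta Let_def)

section \<open>Collisions of hidden elements\<close>

text \<open>By \<open>free\<close>, no hidden element arrives while a different one is stored, so a
  second one never enters. The second conclusion covers everything that can be queried at an
  arrival.\<close>

lemma collision_free:
  fixes S :: "nat \<Rightarrow> 'a set"
  assumes "S 0 = {}" "\<And>t. S (Suc t) \<subseteq> insert (e t) (S t)"
    and free: "\<And>t x. t < n \<Longrightarrow> x \<in> S t \<Longrightarrow> x \<in> H \<Longrightarrow> e t \<in> H \<Longrightarrow> x = e t"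
  shows "t \<le> n \<Longrightarrow> card (S t \<inter> H) \<le> 1" "t < n \<Longrightarrow> card (insert (e t) (S t) \<inter> H) \<le> 1"
proof -
  have fin: "finite (S t)" for t
  proof (induction t)
    case (Suc t)
    then show ?case using finite_subset[OF assms(2)[of t]] by simp
  qed (simp add: assms(1))
  have step: "card (insert (e t) (S t) \<inter> H) \<le> 1" if "card (S t \<inter> H) \<le> 1" "t < n" for t
  proof (cases "e t \<in> H")
    case True
    then have "insert (e t) (S t) \<inter> H \<subseteq> {e t}" using free[OF that(2)] by auto
    then show ?thesis using card_mono[of "{e t}"] by simp
  next
    case False
    then show ?thesis using that by simp
  qed
  have main: "t \<le> n \<Longrightarrow> card (S t \<inter> H) \<le> 1" for t
  proof (induction t)
    case (Suc t)
    have "card (S (Suc t) \<inter> H) \<le> card (insert (e t) (S t) \<inter> H)"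
      using assms(2)[of t] fin by (intro card_mono) auto
    then show ?case using step[of t] Suc by auto
  qed (simp add: assms(1))
  then show "t \<le> n \<Longrightarrow> card (S t \<inter> H) \<le> 1" .
  show "t < n \<Longrightarrow> card (insert (e t) (S t) \<inter> H) \<le> 1" using main[of t] step[of t] by auto
qed

text \<open>A union bound over the arrivals and the at most \<open>s\<close> stored elements. It
  applies because the stores \<open>S\<close> do not depend on \<open>H\<close>.\<close>

lemma collision_count:
  fixes S :: "nat \<Rightarrow> 'a set"
  assumes es: "distinct es" "2 \<le> m" "m \<le> length es"
    and S: "\<And>t. t < length es \<Longrightarrow> S t \<subseteq> set es" "\<And>t. t < length es \<Longrightarrow> card (S t) \<le> s"
  shows "real (card {H. H \<subseteq> set es \<and> card H = m \<and>
            (\<exists>t<length es. \<exists>x\<in>S t. x \<noteq> es ! t \<and> x \<in> H \<and> es ! t \<in> H)})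
    \<le> real s * (real m * (real m - 1)) / (real (length es) - 1) * real (length es choose m)"
proof -
  let ?n = "length es"
  define P where "P x y = {H. H \<subseteq> set es \<and> card H = m \<and> x \<in> H \<and> y \<in> H}" for x y
  \<comment> \<open>The number of \<open>m\<close>-subsets through a fixed pair; summing over all
    arrivals later cancels the factor \<open>?n\<close> in the denominator.\<close>
  define q where "q = real m * (real m - 1) * real (?n choose m) / (real ?n * (real ?n - 1))"
  have n2: "2 \<le> ?n" using es by simp
  have q0: "0 \<le> q" unfolding q_def using es(2) n2 by (intro divide_nonneg_nonneg mult_nonneg_nonneg) auto
  have cP: "real (card (P x y)) = q" if "x \<in> set es" "y \<in> set es" "x \<noteq> y" for x y
  proof -
    have "real (card (P x y)) * (real ?n * (real ?n - 1)) = real m * (real m - 1) * real (?n choose m)"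
      using card_subsets_containing_pair[OF finite_set that es(2)] distinct_card[OF es(1)]
      by (simp add: P_def)
    moreover have "real ?n * (real ?n - 1) \<noteq> 0" using n2 by auto
    ultimately show ?thesis unfolding q_def by (metis nonzero_mult_div_cancel_right)
  qed
  have finP: "finite (P x y)" for x y by (simp add: P_def)
  have fS: "finite (S t)" if "t < ?n" for t using S(1)[OF that] finite_subset by auto
  have inner: "real (card (\<Union>x\<in>S t - {es ! t}. P x (es ! t))) \<le> real s * q" if t: "t < ?n" for t
  proof -
    have "real (card (\<Union>x\<in>S t - {es ! t}. P x (es ! t)))
        \<le> real (\<Sum>x\<in>S t - {es ! t}. card (P x (es ! t)))"
      using fS[OF t] by (intro of_nat_mono card_UN_le) auto
    also have "\<dots> = (\<Sum>x\<in>S t - {es ! t}. q)"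
      unfolding of_nat_sum using S(1)[OF t] t by (intro sum.cong cP) auto
    also have "\<dots> \<le> real s * q"
      using S(2)[OF t] card_mono[OF fS[OF t], of "S t - {es ! t}"] q0
      by (auto intro!: mult_right_mono)
    finally show ?thesis .
  qed
  have "{H. H \<subseteq> set es \<and> card H = m \<and>
            (\<exists>t<?n. \<exists>x\<in>S t. x \<noteq> es ! t \<and> x \<in> H \<and> es ! t \<in> H)}
      = (\<Union>t<?n. \<Union>x\<in>S t - {es ! t}. P x (es ! t))" (is "?L = ?R")
    by (auto simp: P_def)
  then have "real (card ?L) \<le> real (\<Sum>t<?n. card (\<Union>x\<in>S t - {es ! t}. P x (es ! t)))"
    using card_UN_le[of "{..<?n}" "\<lambda>t. \<Union>x\<in>S t - {es ! t}. P x (es ! t)"]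
    by (simp only: of_nat_mono finite_lessThan)
  also have "\<dots> \<le> (\<Sum>t<?n. real s * q)"
    unfolding of_nat_sum using inner by (intro sum_mono) auto
  also have "\<dots> = real s * (real m * (real m - 1)) / (real ?n - 1) * real (?n choose m)"
  proof -
    have "real ?n \<noteq> 0" using n2 by auto
    then show ?thesis by (simp add: q_def)
  qed
  finally show ?thesis .
qed

section \<open>Averaging over hidden sets\<close>

text \<open>All stores are read off the single run on the empty hidden set. An \<open>H\<close>
  without collision there has the same run until \<open>\<tau>\<close> arrives, so its output holds
  at most one hidden element; a colliding \<open>H\<close> is charged the full
  \<open>hard_opt\<close>.\<close>

lemma deterministic_sum_bound:
  fixes A :: "('a, 'w) es_algorithm"
  assumes es: "distinct (es @ [\<tau>])" "2 \<le> m" "m \<le> length es" and p: "m \<le> p"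
    and A: "element_store A"
    and feas: "\<And>H. H \<subseteq> set es \<Longrightarrow> card H = m \<Longrightarrow>
        card (result A (es @ [\<tau>]) (hard_fun m p \<tau> H)) \<le> Suc m"
    and space: "\<And>t. t < length es \<Longrightarrow>
        card (fst (state A (es @ [\<tau>]) (hard_fun m p \<tau> {}) t)) \<le> s"
  shows "(\<Sum>H | H \<subseteq> set es \<and> card H = m. hard_fun m p \<tau> H (result A (es @ [\<tau>]) (hard_fun m p \<tau> H)))
    \<le> real (length es choose m) *
      (max ((real m + 1) * (real m / 2 + real p)) (hard_opt m p - (real m - 1) * real p)
       + real s * (real m * (real m - 1)) / (real (length es) - 1) * hard_opt m p)"
proof -
  let ?es = "es @ [\<tau>]" and ?n = "length es" and ?\<H> = "{H. H \<subseteq> set es \<and> card H = m}"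
  let ?r = "\<lambda>H. result A ?es (hard_fun m p \<tau> H)"
  define B where
    "B = max ((real m + 1) * (real m / 2 + real p)) (hard_opt m p - (real m - 1) * real p)"
  define S where "S t = fst (state A ?es (hard_fun m p \<tau> {}) t)" for t
  define bad where "bad = {H. H \<subseteq> set es \<and> card H = m \<and>
            (\<exists>t<?n. \<exists>x\<in>S t. x \<noteq> es ! t \<and> x \<in> H \<and> es ! t \<in> H)}"
  have B0: "0 \<le> B" by (simp add: B_def le_max_iff_disj)
  have D0: "0 \<le> hard_opt m p" by (simp add: hard_opt_def)
  have m1: "1 \<le> m" using es by simp
  have Ssub: "S t \<subseteq> set es" if "t \<le> ?n" for t
    using state_subset[OF A, of t ?es "hard_fun m p \<tau> {}"] that set_take_subset[of t es]
    by (auto simp: S_def)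
  have \<tau>: "\<tau> \<notin> set es" using es by simp
  have rfin: "finite (?r H)" for H
    using result_subset[OF A, of ?es] state_subset[OF A order_refl, of ?es]
    by (meson finite_set finite_subset)
  have bound: "hard_fun m p \<tau> H (?r H) \<le> B + (if H \<in> bad then hard_opt m p else 0)"
    if H: "H \<in> ?\<H>" for H
  proof (cases "H \<in> bad")
    case True
    have "hard_fun m p \<tau> H (?r H) \<le> hard_opt m p"
      using H m1 rfin finite_subset[of H "set es"] by (intro hard_fun_le_opt) auto
    then show ?thesis using True B0 by simp
  next
    case False
    have S0: "S 0 = {}" by (simp add: S_def)
    have SS: "S (Suc t) \<subseteq> insert (?es ! t) (S t)" for t
      unfolding S_def by (rule state_Suc_subset[OF A])
    have free: "x = ?es ! t" if "t < ?n" "x \<in> S t" "x \<in> H" "?es ! t \<in> H" for t x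
      using False H that unfolding bad_def by (auto simp: nth_append)
    note cf = collision_free[of S "\<lambda>t. ?es ! t" ?n H, OF S0 SS free]
    \<comment> \<open>Before \<open>\<tau>\<close> arrives, all sets that may be queried have at
      most one hidden element, and on these both objectives are \<open>plain_value\<close> of the
      cardinality.\<close>
    have eq: "state A ?es (hard_fun m p \<tau> H) ?n = state A ?es (hard_fun m p \<tau> {}) ?n"
    proof (rule state_cong)
      fix u X assume u: "u < ?n" and X: "X \<subseteq> insert (?es ! u) (fst (state A ?es (hard_fun m p \<tau> {}) u))"
      have X': "X \<subseteq> insert (?es ! u) (S u)" using X by (simp add: S_def)
      have Y: "insert (?es ! u) (S u) \<subseteq> set es"
        using Ssub[of u] u by (auto simp: nth_append)
      have fin: "finite (insert (?es ! u) (S u))" using finite_subset[OF Y finite_set] .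
      have "finite X" using finite_subset[OF X' fin] .
      moreover have "\<tau> \<notin> X" using X' Y \<tau> by auto
      moreover have "card (X \<inter> H) \<le> 1"
      proof -
        have "card (X \<inter> H) \<le> card (insert (?es ! u) (S u) \<inter> H)"
          using X' fin by (intro card_mono) auto
        then show ?thesis using cf(2)[OF _ _ _ _ u] by simp
      qed
      ultimately show "hard_fun m p \<tau> H X = hard_fun m p \<tau> {} X"
        by (simp add: hard_fun_few_hidden)
    qed
    \<comment> \<open>The queries at the last arrival may expose \<open>H\<close>, but by then only
      \<open>\<tau>\<close> can still be added.\<close>
    have "?r H \<subseteq> fst (state A ?es (hard_fun m p \<tau> H) (Suc ?n))"
      using result_subset[OF A, of ?es] by simp
    also have "\<dots> \<subseteq> insert \<tau> (S ?n)"
      using state_Suc_subset[OF A, of ?es "hard_fun m p \<tau> H" ?n] by (simp add: eq S_def)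
    finally have "?r H \<inter> H \<subseteq> S ?n \<inter> H" using H \<tau> by auto
    then have "card (?r H \<inter> H) \<le> card (S ?n \<inter> H)"
      using Ssub[of ?n] finite_subset[of "S ?n" "set es"] by (intro card_mono) auto
    also have "\<dots> \<le> 1" using cf(1)[of ?n] by simp
    finally have "card (?r H \<inter> H) \<le> 1" .
    then have "hard_fun m p \<tau> H (?r H) \<le> B"
      unfolding B_def using H \<tau> feas[of H] finite_subset[of H "set es"]
      by (intro hard_fun_output_bound[OF m1 p rfin]) auto
    then show ?thesis using False by simp
  qed
  have cH: "card ?\<H> = ?n choose m"
    using n_subsets[of "set es" m] distinct_card[of es] es by simp
  have fH: "finite ?\<H>" by simp
  have sub: "bad \<subseteq> ?\<H>" unfolding bad_def by auto
  have "(\<Sum>H\<in>?\<H>. hard_fun m p \<tau> H (?r H)) \<le> (\<Sum>H\<in>?\<H>. B + (if H \<in> bad then hard_opt m p else 0))"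
    using bound by (rule sum_mono)
  also have "\<dots> = real (?n choose m) * B + real (card bad) * hard_opt m p"
    using fH sub by (simp add: sum.distrib cH sum.If_cases Int_absorb1 Int_def[symmetric])
  also have "\<dots> \<le> real (?n choose m) * B
      + real s * (real m * (real m - 1)) / (real ?n - 1) * real (?n choose m) * hard_opt m p"
    unfolding bad_def using es Ssub space D0
    by (intro add_left_mono mult_right_mono collision_count) (auto simp: S_def)
  finally show ?thesis unfolding B_def by (simp add: algebra_simps)
qed

section \<open>From average value to space\<close>

lemma card_le_run_space:
  "t \<le> length es \<Longrightarrow> card (fst (state A es f t)) \<le> run_space A es f"
  unfolding run_space_def by (intro trans_le_add2 Max_ge) auto

lemma run_space_le_space_complexity:
  "\<omega> \<in> space R \<Longrightarrow> is_instance E es f \<Longrightarrow> enat (run_space (A \<omega>) es f) \<le> space_complexity E R A"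
  unfolding space_complexity_def by (intro Sup_upper) auto

text \<open>This serves ground sets too small for the hard instances. Zero space forces an empty
  output, which is worthless for the cardinality objective, whose optimum is at least 1.\<close>

lemma space_complexity_pos:
  assumes E: "finite E" "E \<noteq> {}" and K: "1 \<le> K" and \<alpha>: "0 < \<alpha>"
    and A: "randomized_algorithm E R A" "achieves_ratio E K R A \<alpha>"
  shows "space_complexity E R A \<noteq> 0"
proof
  assume z: "space_complexity E R A = 0"
  obtain es where es: "distinct es" "set es = E" using finite_distinct_list[OF E(1)] by auto
  let ?f = "\<lambda>S. real (card S)"
  have inst: "is_instance E es ?f"
    unfolding is_instance_def submodular_on_def
  proof (intro conjI allI impI mono_onI)
    show "real (card S) \<le> real (card T)" if "S \<in> Pow E" "T \<in> Pow E" "S \<le> T" for S T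
      using that E finite_subset[of T E] by (auto intro: card_mono)
    show "real (card (T \<union> {e})) - real (card T) \<le> real (card (S \<union> {e})) - real (card S)"
      if "S \<subseteq> T \<and> T \<subset> E \<and> e \<in> E - T" for S T e
    proof -
      have "finite T" "finite S" "e \<notin> T" "e \<notin> S"
        using that E finite_subset[of T E] finite_subset[of S T] by auto
      then show ?thesis by simp
    qed
  qed (use es in auto)
  have "result (A \<omega>) es ?f = {}" if \<omega>: "\<omega> \<in> space R" for \<omega>
  proof -
    have A': "element_store (A \<omega>)" using A(1) \<omega> by (simp add: randomized_algorithm_def)
    have "run_space (A \<omega>) es ?f = 0"
      using run_space_le_space_complexity[OF \<omega> inst, of A] z by (simp add: zero_enat_def)
    then have "card (fst (state (A \<omega>) es ?f (length es))) = 0"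
      using card_le_run_space[of "length es" es "A \<omega>" ?f] by simp
    moreover have "finite (fst (state (A \<omega>) es ?f (length es)))"
      using state_subset[OF A' order_refl] finite_subset by blast
    ultimately show ?thesis using result_subset[OF A', of es ?f] by simp
  qed
  then have "(\<integral>\<omega>. ?f (result (A \<omega>) es ?f) \<partial>R) = (\<integral>\<omega>. 0 \<partial>R)"
    by (intro Bochner_Integration.integral_cong) auto
  moreover have "\<alpha> * opt_value E K ?f \<le> (\<integral>\<omega>. ?f (result (A \<omega>) es ?f) \<partial>R)"
    using A(2) inst unfolding achieves_ratio_def by blast
  moreover have "1 \<le> opt_value E K ?f"
  proof -
    obtain e where "e \<in> E" using E by auto
    then have "{e} \<in> feasible_sets E K" using K by (simp add: feasible_sets_def)
    moreover have "finite (feasible_sets E K)" using E by (simp add: feasible_sets_def)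
    ultimately have "?f {e} \<le> opt_value E K ?f" unfolding opt_value_def
      by (intro Max_ge finite_imageI imageI)
    then show ?thesis by simp
  qed
  then have "0 < \<alpha> * opt_value E K ?f" using \<alpha> by (intro mult_pos_pos) auto
  ultimately show False by simp
qed

text \<open>Yao's averaging: the guarantee summed over all \<open>H\<close> is an expectation of
  sums over \<open>H\<close> for fixed seeds, each bounded by
  \<open>deterministic_sum_bound\<close>. The remaining gap \<open>\<epsilon> / 2\<close> must be
  covered by collisions.\<close>

lemma hard_instances_space_bound:
  fixes A :: "'r \<Rightarrow> ('a, 'w) es_algorithm"
  assumes \<epsilon>: "\<epsilon> > 0" and m: "2 \<le> m" "8 / \<epsilon> \<le> real m" and E: "finite E" "m < card E"
    and A: "randomized_algorithm E R A"
      "achieves_ratio E (Suc m) R A (2 / (2 + sqrt 2) + \<epsilon>)"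
    and s: "space_complexity E R A = enat s"
  shows "\<epsilon> / 2 * (real (card E) - 2) \<le> real s * (real m * (real m - 1))"
proof -
  interpret prob_space R using A(1) by (simp add: randomized_algorithm_def)
  have m1: "1 \<le> m" using m by simp
  obtain p where p: "m \<le> p"
    and ratio: "max ((real m + 1) * (real m / 2 + real p)) (hard_opt m p - (real m - 1) * real p)
       \<le> (2 / (2 + sqrt 2) + \<epsilon> / 2) * hard_opt m p"
    using hard_ratio[OF \<epsilon> m1 m(2)] .
  obtain xs where xs: "distinct xs" "set xs = E" using finite_distinct_list[OF E(1)] by auto
  with E have "xs \<noteq> []" by auto
  then obtain es \<tau> where es\<tau>: "xs = es @ [\<tau>]" by (metis rev_exhaust)
  let ?es = "es @ [\<tau>]" and ?\<H> = "{H. H \<subseteq> set es \<and> card H = m}"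
  let ?f = "\<lambda>H \<omega>. hard_fun m p \<tau> H (result (A \<omega>) ?es (hard_fun m p \<tau> H))"
  let ?\<alpha> = "2 / (2 + sqrt 2) + \<epsilon>"
  let ?N = "real (length es choose m)"
  define D where "D = hard_opt m p"
  \<comment> \<open>An upper bound on the fraction of colliding hidden sets. Since \<open>es\<close>
    omits \<open>\<tau>\<close>, its denominator is \<open>card E - 2\<close>.\<close>
  define \<kappa> where "\<kappa> = real s * (real m * (real m - 1)) / (real (length es) - 1)"
  have es: "distinct ?es" "E = insert \<tau> (set es)" "\<tau> \<notin> set es" using xs es\<tau> by auto
  have n: "card E = Suc (length es)" using distinct_card[OF xs(1)] xs(2) es\<tau> by simp
  have D0: "0 < D" using m p unfolding D_def hard_opt_def
    by (intro add_pos_nonneg mult_pos_pos) auto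
  have N0: "0 < ?N" using n E by simp
  have inst: "is_instance E ?es (hard_fun m p \<tau> H)" if "H \<subseteq> set es" "card H \<le> m" for H
    using that es m1 by (intro hard_fun_instance) auto
  have int: "integrable R (?f H)" if "H \<in> ?\<H>" for H
  proof (rule integrable_const_bound[of _ D])
    have i: "is_instance E ?es (hard_fun m p \<tau> H)" using that inst by simp
    then have "(\<lambda>\<omega>. result (A \<omega>) ?es (hard_fun m p \<tau> H)) \<in> measurable R (count_space (Pow E))"
      using A(1) unfolding randomized_algorithm_def by blast
    then show "?f H \<in> borel_measurable R" by (rule measurable_compose) simp
    have "norm (?f H \<omega>) \<le> D" if "\<omega> \<in> space R" for \<omega>
    proof -
      have "result (A \<omega>) ?es (hard_fun m p \<tau> H) \<subseteq> E"
        using A(2) i that unfolding achieves_ratio_def feasible_sets_def by blast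
      then show ?thesis
        using i hard_fun_le_opt[of m "result (A \<omega>) ?es (hard_fun m p \<tau> H)" H p \<tau>] m1 \<open>H \<in> ?\<H>\<close>
          finite_subset[of _ E] finite_subset[of H "set es"] E
        by (auto simp: is_instance_def D_def)
    qed
    then show "AE \<omega> in R. norm (?f H \<omega>) \<le> D" by simp
  qed
  have "?N * (?\<alpha> * D) = (\<Sum>H\<in>?\<H>. ?\<alpha> * D)"
    using n_subsets[of "set es" m] distinct_card[of es] es by simp
  also have "\<dots> \<le> (\<Sum>H\<in>?\<H>. expectation (?f H))"
  proof (rule sum_mono)
    fix H assume H: "H \<in> ?\<H>"
    have "?\<alpha> * D \<le> ?\<alpha> * opt_value E (Suc m) (hard_fun m p \<tau> H)"
      unfolding D_def using H m1 E es \<epsilon> by (intro mult_left_mono opt_value_hard_fun) auto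
    also have "\<dots> \<le> expectation (?f H)"
      using A(2) inst[of H] H unfolding achieves_ratio_def by auto
    finally show "?\<alpha> * D \<le> expectation (?f H)" .
  qed
  also have "\<dots> = expectation (\<lambda>\<omega>. \<Sum>H\<in>?\<H>. ?f H \<omega>)"
    using int by (intro Bochner_Integration.integral_sum[symmetric])
  also have "\<dots> \<le> ?N * ((2 / (2 + sqrt 2) + \<epsilon> / 2) * D + \<kappa> * D)"
  proof (rule integral_le_const)
    show "integrable R (\<lambda>\<omega>. \<Sum>H\<in>?\<H>. ?f H \<omega>)" using int by auto
    have "(\<Sum>H\<in>?\<H>. ?f H \<omega>) \<le> ?N * ((2 / (2 + sqrt 2) + \<epsilon> / 2) * D + \<kappa> * D)"
      if \<omega>: "\<omega> \<in> space R" for \<omega>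
    proof -
      have "(\<Sum>H\<in>?\<H>. ?f H \<omega>) \<le> ?N *
          (max ((real m + 1) * (real m / 2 + real p)) (hard_opt m p - (real m - 1) * real p)
           + \<kappa> * D)"
        unfolding \<kappa>_def D_def
      proof (rule deterministic_sum_bound)
        show "distinct ?es" "2 \<le> m" "m \<le> p" by fact+
        show "m \<le> length es" using E n by simp
        show "element_store (A \<omega>)" using A(1) \<omega> by (simp add: randomized_algorithm_def)
        show "card (result (A \<omega>) ?es (hard_fun m p \<tau> H)) \<le> Suc m"
          if "H \<subseteq> set es" "card H = m" for H
          using A(2) inst[of H] that \<omega> unfolding achieves_ratio_def feasible_sets_def by auto
        show "card (fst (state (A \<omega>) ?es (hard_fun m p \<tau> {}) t)) \<le> s" if "t < length es" for t
          using run_space_le_space_complexity[OF \<omega> inst[of "{}"], of A] that s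
            card_le_run_space[of t ?es "A \<omega>" "hard_fun m p \<tau> {}"] by simp
      qed
      also have "\<dots> \<le> ?N * ((2 / (2 + sqrt 2) + \<epsilon> / 2) * D + \<kappa> * D)"
        using ratio by (intro mult_left_mono add_right_mono) (auto simp: D_def)
      finally show ?thesis .
    qed
    then show "AE \<omega> in R. (\<Sum>H\<in>?\<H>. ?f H \<omega>) \<le> ?N * ((2 / (2 + sqrt 2) + \<epsilon> / 2) * D + \<kappa> * D)"
      by simp
  qed
  finally have "?\<alpha> * D \<le> (2 / (2 + sqrt 2) + \<epsilon> / 2 + \<kappa>) * D"
    using N0 by (simp add: distrib_right)
  then have "\<epsilon> / 2 \<le> \<kappa>" using D0 by simp
  moreover have "real (length es) - 1 > 0" using E n m by simp
  ultimately show ?thesis unfolding \<kappa>_def n by (simp add: field_simps)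
qed

theorem theorem1p2:
  fixes \<epsilon> :: real
  assumes "\<epsilon> > 0"
  shows "\<exists>c>0. \<exists>K\<^sub>0::nat. \<forall>K\<ge>K\<^sub>0. \<forall>n::nat.
           \<forall>(E :: 'a set) (R :: 'r measure) (A :: 'r \<Rightarrow> ('a, 'w) es_algorithm).
             finite E \<and> card E = n \<and>
             randomized_algorithm E R A \<and>
             achieves_ratio E K R A (2 / (2 + sqrt 2) + \<epsilon>) \<longrightarrow>
             ereal (c * real n / (real K)\<^sup>2) \<le> ereal_of_enat (space_complexity E R A)"
proof -
  \<comment> \<open>\<open>\<epsilon> / 4\<close> serves the case \<open>m < n\<close>, and
    \<open>1\<close> the case \<open>n \<le> m\<close>.\<close>
  define c where "c = min 1 (\<epsilon> / 4)"
  \<comment> \<open>The bound \<open>4\<close> gives \<open>m \<ge> 3\<close>, so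
    \<open>m < n\<close> implies \<open>n \<ge> 4\<close> and \<open>n - 2 \<ge> n / 2\<close>; the
    other bound gives \<open>8 / \<epsilon> \<le> m\<close>.\<close>
  define K0 where "K0 = max 4 (Suc (nat \<lceil>8 / \<epsilon>\<rceil>))"
  have c: "0 < c" "c \<le> 1" "c \<le> \<epsilon> / 4" using assms by (auto simp: c_def)
  have "ereal (c * real n / (real K)\<^sup>2) \<le> ereal_of_enat (space_complexity E R A)"
    if K: "K \<ge> K0" and E: "finite E" "card E = n" and A: "randomized_algorithm E R A"
      "achieves_ratio E K R A (2 / (2 + sqrt 2) + \<epsilon>)"
    for K n and E :: "'a set" and R :: "'r measure" and A :: "'r \<Rightarrow> ('a, 'w) es_algorithm"
  proof (cases "space_complexity E R A")
    case (enat s)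
    obtain m where m: "K = Suc m" using K by (cases K) (auto simp: K0_def)
    have m3: "3 \<le> m" "8 / \<epsilon> \<le> real m" using K unfolding m K0_def by linarith+
    have K0: "0 < (real K)\<^sup>2" using m by simp
    have "c * real n \<le> real s * (real K)\<^sup>2"
    proof (cases "m < n")
      case True
      have "\<epsilon> / 2 * (real n - 2) \<le> real s * (real m * (real m - 1))"
        using hard_instances_space_bound[OF assms _ m3(2) E(1) _ A(1) _ enat] A(2) m m3 E(2) True
        by simp
      moreover have "\<epsilon> / 4 * real n \<le> \<epsilon> / 2 * (real n - 2)"
        using True m3 assms by simp
      moreover have "c * real n \<le> \<epsilon> / 4 * real n" using c by (intro mult_right_mono) auto
      moreover have "real s * (real m * (real m - 1)) \<le> real s * (real K)\<^sup>2"
        unfolding m power2_eq_square using m3 by (intro mult_left_mono mult_mono) auto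
      ultimately show ?thesis by linarith
    next
      \<comment> \<open>Now \<open>n \<le> m < K\<close>, so any positive space suffices.\<close>
      case False
      show ?thesis
      proof (cases "n = 0")
        case n0: False
        have "s \<noteq> 0"
          using space_complexity_pos[OF E(1) _ _ _ A] E(2) n0 m assms enat card_gt_0_iff[of E]
          by (auto simp: zero_enat_def add_pos_pos)
        have "c * real n \<le> 1 * real K" using c False m by (intro mult_mono) auto
        also have "\<dots> \<le> 1 * (real K)\<^sup>2" using m by (simp add: power2_eq_square)
        also have "\<dots> \<le> real s * (real K)\<^sup>2" using \<open>s \<noteq> 0\<close> by (intro mult_right_mono) auto
        finally show ?thesis .
      qed simp
    qed
    then show ?thesis using K0 enat by (simp add: pos_divide_le_eq)
  \<comment> \<open>What remains is infinite space, where the right-hand side is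
    \<open>\<infinity>\<close>.\<close>
  qed simp
  then show ?thesis using c(1) by (intro exI[of _ c] conjI exI[of _ K0]) blast+
qed

end
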